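(* Let $\mathcal{K}$ be a class of models of the same vocabulary. Then the following conditions are equivalent: (1) $\mathcal{K}$ is closed under isomorphisms. (2) $\mathcal{K}$ is cardinal dependently definable in $\Delta(L_{\infty\omega})$; that is, for every cardinal $\lambda$ the class $\mathcal{K}_\lambda$ of those members of $\mathcal{K}$ whose domain has cardinality $\lambda$ is $\Delta$-definable in $L_{\infty\omega}$.
   Context: A vocabulary is a set of non-logical symbols; models (structures) have set-sized domains and are single-sorted. Classes are definable classes of set theory (set parameters are allowed in the definition). $L_{\infty\omega}=\bigcup_\kappa L_{\kappa^+\omega}$ is the infinitary logic extending first order logic with conjunctions and disjunctions of arbitrary sets of formulas, but only finite strings of quantifiers. A class of models of a vocabulary $L$ is $L_{\infty\omega}$-definable if it is the class of all $L$-structures satisfying some single sentence of $L_{\infty\omega}$ in the vocabulary $L$. If $\mathcal{C}$ is a class of models of vocabulary $L$ and $L'\subseteq L$, then $\mathcal{C}\upharpoonright L'$ denotes the class of reducts $\mathcal{M}\upharpoonright L'$ of models $\mathcal{M}\in\mathcal{C}$, and $\mathcal{C}\upharpoonright L'$ is called a projection of $\mathcal{C}$. A class of models is $\Sigma(L^* )$-definable (for a logic $L^*$) if it is a projection of an $L^*$-definable class of models. A class $\mathcal{C}$ of models of a vocabulary is $\Delta$-definable in $L^*$ (equivalently, definable in $\Delta(L^* )$) if both $\mathcal{C}$ and its complement (in the class of all structures of that vocabulary) are $\Sigma(L^* )$-definable. The single-sorted version is used: projections only forget symbols and do not change the domain. *)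

theory Defs
  imports Main
begin

unbundle cardinal_syntax

text \<open>
  The universe of set theory is rendered by a type \<open>'u\<close> whose cardinality is an
  uncountable strongly inaccessible cardinal.  Such a type is, up to a bijection, a universe
  of sets (a rank \<open>V\<^sub>\<theta>\<close> of the cumulative hierarchy with \<open>\<theta>\<close> inaccessible), and the
  subsets of it that are sets, rather than proper classes, are exactly those of cardinality
  less than that of \<open>'u\<close>.  So a collection is ``set-sized'' iff its cardinality is
  below \<open>|UNIV :: 'u set|\<close>; classes are arbitrary collections.
\<close>

definition set_universe :: "'u itself \<Rightarrow> bool" where
  "set_universe _ \<longleftrightarrow>
     natLeq <o |UNIV :: 'u set| \<and>
     regularCard |UNIV :: 'u set| \<and>
     (\<forall>A :: 'u set. |A| <o |UNIV :: 'u set| \<longrightarrow> |Pow A| <o |UNIV :: 'u set| )"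

text \<open>The cardinals of the universe, finite ones included, as initial well-orders.\<close>

definition cardinal :: "'u rel \<Rightarrow> bool" where
  "cardinal k \<longleftrightarrow> Card_order k \<and> k <o |UNIV :: 'u set|"

text \<open>Symbols carry their arity; constant symbols are function symbols of arity 0.\<close>

datatype 'u symbol = Rel 'u nat | Fun 'u nat

definition vocabulary :: "'u symbol set \<Rightarrow> bool" where
  "vocabulary L \<longleftrightarrow> |L| <o |UNIV :: 'u set|"

text \<open>
  The arity of an application is the length of its argument list: \<open>rel_of M r xs\<close> is the
  truth value of \<open>Rel r (length xs)\<close> at \<open>xs\<close>, and similarly for \<open>fun_of\<close>.
\<close>

datatype 'u struct = Struct
  (carrier_of: "'u set")
  (rel_of: "'u \<Rightarrow> 'u list \<Rightarrow> bool")
  (fun_of: "'u \<Rightarrow> 'u list \<Rightarrow> 'u")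

text \<open>
  The class of all \<open>L\<close>-structures.  Interpretations take a default value outside \<open>L\<close> and
  outside the domain, so that two structures are equal iff they have the same domain and the
  same interpretation of each symbol of \<open>L\<close>.
\<close>

definition structures :: "'u symbol set \<Rightarrow> 'u struct set" where
  "structures L =
     {M. carrier_of M \<noteq> {} \<and> |carrier_of M| <o |UNIV :: 'u set| \<and>
         (\<forall>r xs. rel_of M r xs \<longrightarrow> Rel r (length xs) \<in> L \<and> set xs \<subseteq> carrier_of M) \<and>
         (\<forall>f xs. if Fun f (length xs) \<in> L \<and> set xs \<subseteq> carrier_of M
                 then fun_of M f xs \<in> carrier_of M
                 else fun_of M f xs = undefined)}"

definition isomorphic :: "'u symbol set \<Rightarrow> 'u struct \<Rightarrow> 'u struct \<Rightarrow> bool" where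
  "isomorphic L M N \<longleftrightarrow>
     (\<exists>h. bij_betw h (carrier_of M) (carrier_of N) \<and>
          (\<forall>r xs. Rel r (length xs) \<in> L \<longrightarrow> set xs \<subseteq> carrier_of M \<longrightarrow>
                  (rel_of M r xs \<longleftrightarrow> rel_of N r (map h xs))) \<and>
          (\<forall>f xs. Fun f (length xs) \<in> L \<longrightarrow> set xs \<subseteq> carrier_of M \<longrightarrow>
                  h (fun_of M f xs) = fun_of N f (map h xs)))"

definition closed_under_isomorphisms :: "'u symbol set \<Rightarrow> 'u struct set \<Rightarrow> bool" where
  "closed_under_isomorphisms L K \<longleftrightarrow>
     (\<forall>M \<in> K. \<forall>N \<in> structures L. isomorphic L M N \<longrightarrow> N \<in> K)"

definition reduct :: "'u symbol set \<Rightarrow> 'u struct \<Rightarrow> 'u struct" where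
  "reduct L M =
     Struct (carrier_of M)
       (\<lambda>r xs. Rel r (length xs) \<in> L \<and> rel_of M r xs)
       (\<lambda>f xs. if Fun f (length xs) \<in> L then fun_of M f xs else undefined)"

datatype 'u tm = Var nat | App 'u "'u tm list"

text \<open>
  Conjunctions and disjunctions are taken over families \<open>\<phi>\<close> indexed by a set \<open>I\<close>; the values
  of \<open>\<phi>\<close> outside \<open>I\<close> are irrelevant.
\<close>

datatype 'u fm =
    Eq "'u tm" "'u tm"
  | Atom 'u "'u tm list"
  | Neg "'u fm"
  | Conj "'u set" "'u \<Rightarrow> 'u fm"
  | Disj "'u set" "'u \<Rightarrow> 'u fm"
  | Ex nat "'u fm"
  | All nat "'u fm"

primrec vars_tm :: "'u tm \<Rightarrow> nat set" where
  "vars_tm (Var x) = {x}"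
| "vars_tm (App f ts) = \<Union> (set (map vars_tm ts))"

primrec free_vars :: "'u fm \<Rightarrow> nat set" where
  "free_vars (Eq s t) = vars_tm s \<union> vars_tm t"
| "free_vars (Atom r ts) = \<Union> (vars_tm ` set ts)"
| "free_vars (Neg p) = free_vars p"
| "free_vars (Conj I \<phi>) = (\<Union>i\<in>I. free_vars (\<phi> i))"
| "free_vars (Disj I \<phi>) = (\<Union>i\<in>I. free_vars (\<phi> i))"
| "free_vars (Ex x p) = free_vars p - {x}"
| "free_vars (All x p) = free_vars p - {x}"

primrec term_of :: "'u symbol set \<Rightarrow> 'u tm \<Rightarrow> bool" where
  "term_of L (Var x) \<longleftrightarrow> True"
| "term_of L (App f ts) \<longleftrightarrow> Fun f (length ts) \<in> L \<and> list_all (term_of L) ts"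

text \<open>
  \<open>formula_of L k p\<close>: \<open>p\<close> is a formula of \<open>L\<^bsub>k\<^sup>+\<omega>\<^esub>\<close> in the vocabulary \<open>L\<close>, that is,
  all its conjunctions and disjunctions have fewer than \<open>k\<^sup>+\<close>, i.e. at most \<open>k\<close>, members.
\<close>

primrec formula_of :: "'u symbol set \<Rightarrow> 'u rel \<Rightarrow> 'u fm \<Rightarrow> bool" where
  "formula_of L k (Eq s t) \<longleftrightarrow> term_of L s \<and> term_of L t"
| "formula_of L k (Atom r ts) \<longleftrightarrow> Rel r (length ts) \<in> L \<and> list_all (term_of L) ts"
| "formula_of L k (Neg p) \<longleftrightarrow> formula_of L k p"
| "formula_of L k (Conj I \<phi>) \<longleftrightarrow> |I| \<le>o k \<and> (\<forall>i\<in>I. formula_of L k (\<phi> i))"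
| "formula_of L k (Disj I \<phi>) \<longleftrightarrow> |I| \<le>o k \<and> (\<forall>i\<in>I. formula_of L k (\<phi> i))"
| "formula_of L k (Ex x p) \<longleftrightarrow> formula_of L k p"
| "formula_of L k (All x p) \<longleftrightarrow> formula_of L k p"

definition Linf_sentence :: "'u symbol set \<Rightarrow> 'u fm \<Rightarrow> bool" where
  "Linf_sentence L p \<longleftrightarrow> (\<exists>k. cardinal k \<and> formula_of L k p) \<and> free_vars p = {}"

primrec eval_tm :: "'u struct \<Rightarrow> (nat \<Rightarrow> 'u) \<Rightarrow> 'u tm \<Rightarrow> 'u" where
  "eval_tm M e (Var x) = e x"
| "eval_tm M e (App f ts) = fun_of M f (map (eval_tm M e) ts)"

primrec sat :: "'u struct \<Rightarrow> 'u fm \<Rightarrow> (nat \<Rightarrow> 'u) \<Rightarrow> bool" where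
  "sat M (Eq s t) e \<longleftrightarrow> eval_tm M e s = eval_tm M e t"
| "sat M (Atom r ts) e \<longleftrightarrow> rel_of M r (map (eval_tm M e) ts)"
| "sat M (Neg p) e \<longleftrightarrow> \<not> sat M p e"
| "sat M (Conj I \<phi>) e \<longleftrightarrow> (\<forall>i\<in>I. sat M (\<phi> i) e)"
| "sat M (Disj I \<phi>) e \<longleftrightarrow> (\<exists>i\<in>I. sat M (\<phi> i) e)"
| "sat M (Ex x p) e \<longleftrightarrow> (\<exists>a\<in>carrier_of M. sat M p (e(x := a)))"
| "sat M (All x p) e \<longleftrightarrow> (\<forall>a\<in>carrier_of M. sat M p (e(x := a)))"

definition models :: "'u struct \<Rightarrow> 'u fm \<Rightarrow> bool" where
  "models M p \<longleftrightarrow> (\<forall>e. range e \<subseteq> carrier_of M \<longrightarrow> sat M p e)"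

text \<open>
  Of a logic only its definability relation matters here: which classes of structures of a
  vocabulary \<open>L\<close> are definable by a single sentence in the vocabulary \<open>L\<close>.
\<close>

type_synonym 'u logic = "'u symbol set \<Rightarrow> 'u struct set \<Rightarrow> bool"

definition Linf_definable :: "'u logic" where
  "Linf_definable L C \<longleftrightarrow> (\<exists>p. Linf_sentence L p \<and> C = {M \<in> structures L. models M p})"

definition Sigma_definable :: "'u logic \<Rightarrow> 'u logic" where
  "Sigma_definable D L C \<longleftrightarrow>
     (\<exists>L' C'. vocabulary L' \<and> L \<subseteq> L' \<and> D L' C' \<and> C = reduct L ` C')"

definition Delta_definable :: "'u logic \<Rightarrow> 'u logic" where
  "Delta_definable D L C \<longleftrightarrow> Sigma_definable D L C \<and> Sigma_definable D L (structures L - C)"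

definition of_cardinality :: "'u struct set \<Rightarrow> 'u rel \<Rightarrow> 'u struct set" where
  "of_cardinality K k = {M \<in> K. |carrier_of M| =o k}"

definition cardinal_dependently_definable ::
    "'u logic \<Rightarrow> 'u symbol set \<Rightarrow> 'u struct set \<Rightarrow> bool" where
  "cardinal_dependently_definable D L K \<longleftrightarrow> (\<forall>k. cardinal k \<longrightarrow> D L (of_cardinality K k))"

end

theory Submission
  imports Defs
begin

text \<open>
  Fix a cardinal \<open>k\<close> and name the elements of a structure by new constants from a set \<open>B\<close> with
  \<open>|B| = 2\<^sup>k\<close>.  If every element is named, the truth values of the atomic sentences in the
  names determine the structure up to isomorphism; if distinct constants denote distinct
  elements, the structure has at least \<open>|B| > k\<close> elements.  Every structure has an expansion of
  one of these two kinds.  Since there is only a set of atomic sentences, and a set of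
  possible patterns of truth values, any class that is closed under isomorphisms and does
  not distinguish between structures with at least \<open>|B|\<close> elements is the projection of an
  \<open>L\<^bsub>\<infinity>\<omega>\<^esub>\<close>-definable class.  The latter property passes to complements, and
  \<open>K\<^sub>k\<close> has it, whence \<open>\<Delta>\<close>-definability.  Conversely, satisfaction is invariant
  under isomorphisms, and an expansion can be transported along an isomorphism of reducts.
\<close>

section \<open>Sizes below the universe\<close>

lemma infinite_universe:
  assumes "set_universe TYPE('u)"
  shows "infinite (UNIV :: 'u set)"
  using assms infinite_iff_natLeq_ordLeq ordLess_imp_ordLeq unfolding set_universe_def by blast

lemma small_finite:
  assumes "set_universe TYPE('u)" "finite A"
  shows "|A| <o |UNIV :: 'u set|"
  using finite_ordLess_infinite[OF card_of_Well_order card_of_Well_order]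
    infinite_universe[OF assms(1)] assms(2)
  by (simp add: Field_card_of)

lemma small_Un:
  assumes "set_universe TYPE('u)" "|A| <o |UNIV :: 'u set|" "|B| <o |UNIV :: 'u set|"
  shows "|A \<union> B| <o |UNIV :: 'u set|"
  using card_of_Un_ordLess_infinite[OF infinite_universe] assms by blast

text \<open>The product embeds into the square of the disjoint sum \<open>C\<close>. An infinite
  \<open>C\<close> is equinumerous with its square; a finite square is small as the universe is
  infinite.\<close>

lemma small_Times:
  assumes "set_universe TYPE('u)" "|A| <o |UNIV :: 'u set|" "|B| <o |UNIV :: 'u set|"
  shows "|A \<times> B| <o |UNIV :: 'u set|"
proof -
  define C where "C = A <+> B"
  have C: "|C| <o |UNIV :: 'u set|"
    unfolding C_def using card_of_Plus_ordLess_infinite[OF infinite_universe] assms by blast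
  have "|C \<times> C| <o |UNIV :: 'u set|"
  proof (cases "finite C")
    case True
    then show ?thesis
      by (intro small_finite assms) simp
  next
    case False
    then show ?thesis
      using card_of_Times_same_infinite C ordIso_ordLess_trans by blast
  qed
  moreover have "|A \<times> B| \<le>o |C \<times> C|"
    by (rule card_of_ordLeqI[where f = "\<lambda>(a, b). (Inl a, Inr b)"])
      (auto simp: C_def inj_on_def)
  ultimately show ?thesis
    using ordLeq_ordLess_trans by blast
qed

lemma small_image:
  assumes "|A| <o |UNIV :: 'u set|"
  shows "|f ` A| <o |UNIV :: 'u set|"
  using card_of_image assms ordLeq_ordLess_trans by blast

lemma small_subset:
  assumes "|A| <o |UNIV :: 'u set|" "B \<subseteq> A"
  shows "|B| <o |UNIV :: 'u set|"
  using card_of_mono1[OF assms(2)] assms(1) ordLeq_ordLess_trans by blast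

lemma ordLeq_obtains_bij:
  assumes "|A| \<le>o |B|"
  obtains C f where "C \<subseteq> B" "bij_betw f C A"
proof -
  obtain g where g: "inj_on g A" "g ` A \<subseteq> B"
    using assms card_of_ordLeq[of A B] by blast
  show thesis
    by (rule that[OF g(2) bij_betw_inv_into[OF inj_on_imp_bij_betw[OF g(1)]]])
qed

text \<open>Connectives take index sets inside the type \<open>'u\<close>, so a small family of
  formulas must first be reindexed by such a set.\<close>

lemma small_obtains_bij:
  assumes "|A| <o |UNIV :: 'u set|"
  obtains C :: "'u set" and f where "bij_betw f C A" "|C| <o |UNIV :: 'u set|"
proof -
  obtain C :: "'u set" and f where f: "bij_betw f C A"
    by (rule ordLeq_obtains_bij[OF ordLess_imp_ordLeq[OF assms]])
  then have "|C| =o |A|"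
    using card_of_ordIso by blast
  from that[OF f ordIso_ordLess_trans[OF this assms]] show thesis .
qed

text \<open>\<open>set_universe\<close> speaks only of power sets of subsets of \<open>'u\<close>; a
  bijection carries this over to small sets of any type.\<close>

lemma small_Pow:
  assumes "set_universe TYPE('u)" "|A| <o |UNIV :: 'u set|"
  shows "|Pow A| <o |UNIV :: 'u set|"
proof -
  obtain C :: "'u set" and f where f: "bij_betw f C A" and "|C| <o |UNIV :: 'u set|"
    by (rule small_obtains_bij[OF assms(2)])
  then have small: "|Pow C| <o |UNIV :: 'u set|"
    using assms(1) unfolding set_universe_def by blast
  have "|Pow C| =o |Pow A|"
    using bij_betw_Pow[OF f] card_of_ordIso by blast
  then show ?thesis
    by (rule ordIso_ordLess_trans[OF ordIso_symmetric small])
qed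

text \<open>A list is determined by its graph, a set of pairs of positions and entries. This crude
  bound suffices because smallness is preserved by power sets.\<close>

lemma small_lists:
  fixes A :: "'a set"
  assumes "set_universe TYPE('u)" "|A| <o |UNIV :: 'u set|"
  shows "|lists A| <o |UNIV :: 'u set|"
proof -
  have "|UNIV :: nat set| <o |UNIV :: 'u set|"
    using assms(1) card_of_nat ordIso_ordLess_trans unfolding set_universe_def by blast
  then have "|Pow ((UNIV :: nat set) \<times> A)| <o |UNIV :: 'u set|"
    by (intro small_Pow small_Times assms)
  moreover have "|lists A| \<le>o |Pow ((UNIV :: nat set) \<times> A)|"
  proof (rule card_of_ordLeqI)
    define graph where "graph xs = {(i, xs ! i) |i. i < length xs}" for xs :: "'a list"
    \<comment> \<open>The graph has one point for each position, so its cardinality recovers the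
      length; equal graphs then agree entry by entry.\<close>
    have length: "length xs = card (graph xs)" for xs
    proof -
      have "graph xs = (\<lambda>i. (i, xs ! i)) ` {..<length xs}"
        unfolding graph_def by auto
      moreover have "inj_on (\<lambda>i. (i, xs ! i)) {..<length xs}"
        by (auto intro: inj_onI)
      ultimately show ?thesis
        by (simp add: card_image)
    qed
    show "inj_on graph (lists A)"
    proof (rule inj_onI)
      fix xs ys assume eq: "graph xs = graph ys"
      then have len: "length xs = length ys"
        using length by metis
      then show "xs = ys"
        using eq by (intro nth_equalityI) (auto simp: graph_def set_eq_iff)
    qed
    show "graph xs \<in> Pow (UNIV \<times> A)" if "xs \<in> lists A" for xs
      using that by (auto simp: graph_def in_lists_conv_set)
  qed
  ultimately show ?thesis
    using ordLeq_ordLess_trans by blast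
qed

text \<open>The complement of a small set is as large as the universe, since otherwise the universe
  would be a union of two small sets. It has room for a copy of any small set.\<close>

lemma obtains_fresh_set:
  fixes N :: "'u set"
  assumes "set_universe TYPE('u)" "|N| <o |UNIV :: 'u set|" "|A| <o |UNIV :: 'u set|"
  obtains B :: "'u set" where "B \<inter> N = {}" "|B| =o |A|"
proof -
  have "\<not> |UNIV - N| <o |UNIV :: 'u set|"
  proof
    assume "|UNIV - N| <o |UNIV :: 'u set|"
    then have "|(UNIV - N) \<union> N| <o |UNIV :: 'u set|"
      using small_Un assms by blast
    then show False
      using not_ordLess_ordIso card_of_refl by (simp add: Un_commute) blast
  qed
  then have "|UNIV :: 'u set| \<le>o |UNIV - N|"
    using not_ordLess_iff_ordLeq card_of_Well_order by blast
  then have "|A| \<le>o |UNIV - N|"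
    using assms(3) ordLess_imp_ordLeq ordLeq_transitive by blast
  then obtain B f where "B \<subseteq> UNIV - N" "bij_betw f B A"
    by (rule ordLeq_obtains_bij)
  then show thesis
    using that[of B] card_of_ordIso by blast
qed

section \<open>Structures and isomorphisms\<close>

lemma carrier_reduct [simp]: "carrier_of (reduct L M) = carrier_of M"
  by (simp add: reduct_def)

lemma rel_ofD:
  assumes "M \<in> structures L" "rel_of M r xs"
  shows "Rel r (length xs) \<in> L" "set xs \<subseteq> carrier_of M"
  using assms unfolding structures_def by auto

lemma fun_of_undefined:
  assumes "M \<in> structures L" "\<not> (Fun f (length xs) \<in> L \<and> set xs \<subseteq> carrier_of M)"
  shows "fun_of M f xs = undefined"
  using assms unfolding structures_def by (auto split: if_splits)

lemma reduct_in_structures: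
  assumes "L \<subseteq> L'" "M \<in> structures L'"
  shows "reduct L M \<in> structures L"
  using assms unfolding structures_def reduct_def by (fastforce split: if_splits)

lemma subset_image_lists:
  assumes "set xs \<subseteq> f ` A"
  obtains ys where "set ys \<subseteq> A" "xs = map f ys"
proof -
  have "xs \<in> map f ` lists A"
    unfolding lists_image[symmetric] using assms by (simp add: in_lists_conv_set subset_iff)
  then show thesis
    using that by (auto simp: in_lists_conv_set)
qed

text \<open>Outside the vocabulary or the domain both structures take the forced default values, so
  nothing else remains to be compared.\<close>

lemma structures_eqI:
  assumes "M \<in> structures L" "N \<in> structures L" "carrier_of M = carrier_of N"
    and "\<And>r xs. Rel r (length xs) \<in> L \<Longrightarrow> set xs \<subseteq> carrier_of M \<Longrightarrow> rel_of M r xs = rel_of N r xs"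
    and "\<And>f xs. Fun f (length xs) \<in> L \<Longrightarrow> set xs \<subseteq> carrier_of M \<Longrightarrow> fun_of M f xs = fun_of N f xs"
  shows "M = N"
proof (rule struct.expand, intro conjI ext)
  show "rel_of M r xs = rel_of N r xs" for r xs
    using rel_ofD[OF assms(1)] rel_ofD[OF assms(2)] assms(3,4) by metis
  show "fun_of M f xs = fun_of N f xs" for f xs
  proof (cases "Fun f (length xs) \<in> L \<and> set xs \<subseteq> carrier_of M")
    case False
    then show ?thesis
      using fun_of_undefined[OF assms(1)] fun_of_undefined[OF assms(2)] assms(3) by simp
  qed (use assms(5)[of f xs] in blast)
qed (fact assms(3))

lemma fun_of_in_carrier:
  assumes "M \<in> structures L" "Fun f (length xs) \<in> L" "set xs \<subseteq> carrier_of M"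
  shows "fun_of M f xs \<in> carrier_of M"
  using assms unfolding structures_def by (auto split: if_splits)

definition isomorphism :: "'u symbol set \<Rightarrow> ('u \<Rightarrow> 'u) \<Rightarrow> 'u struct \<Rightarrow> 'u struct \<Rightarrow> bool" where
  "isomorphism L h M N \<longleftrightarrow>
     bij_betw h (carrier_of M) (carrier_of N) \<and>
     (\<forall>r xs. Rel r (length xs) \<in> L \<longrightarrow> set xs \<subseteq> carrier_of M \<longrightarrow>
             (rel_of M r xs \<longleftrightarrow> rel_of N r (map h xs))) \<and>
     (\<forall>f xs. Fun f (length xs) \<in> L \<longrightarrow> set xs \<subseteq> carrier_of M \<longrightarrow>
             h (fun_of M f xs) = fun_of N f (map h xs))"

lemma isomorphic_iff: "isomorphic L M N \<longleftrightarrow> (\<exists>h. isomorphism L h M N)"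
  unfolding isomorphic_def isomorphism_def ..

lemma isomorphism_reduct:
  assumes "L \<subseteq> L'" "isomorphism L' h M N"
  shows "isomorphism L h (reduct L M) (reduct L N)"
  using assms unfolding isomorphism_def reduct_def by auto

text \<open>Since \<open>h\<close> is onto, each tuple of \<open>N\<close> is the image of a tuple
  of \<open>M\<close>, which dictates the interpretation there. This later identifies the reduct of
  a transported expansion with a given structure.\<close>

lemma isomorphism_unique:
  assumes "N \<in> structures L" "N' \<in> structures L" "isomorphism L h M N" "isomorphism L h M N'"
    and "carrier_of N = carrier_of N'"
  shows "N = N'"
proof (rule structures_eqI)
  have lift: "\<exists>ys. set ys \<subseteq> carrier_of M \<and> xs = map h ys" if "set xs \<subseteq> carrier_of N" for xs
  proof -
    have "set xs \<subseteq> h ` carrier_of M"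
      using that assms(3) unfolding isomorphism_def bij_betw_def by simp
    then show ?thesis
      by (rule subset_image_lists) blast
  qed
  show "rel_of N r xs = rel_of N' r xs"
    if "Rel r (length xs) \<in> L" "set xs \<subseteq> carrier_of N" for r xs
    using lift[OF that(2)] that(1) assms(3,4) unfolding isomorphism_def by fastforce
  show "fun_of N f xs = fun_of N' f xs"
    if "Fun f (length xs) \<in> L" "set xs \<subseteq> carrier_of N" for f xs
  proof -
    from lift[OF that(2)] obtain ys where "set ys \<subseteq> carrier_of M" "xs = map h ys"
      by blast
    then show ?thesis
      using that(1) assms(3,4) unfolding isomorphism_def by (metis length_map)
  qed
qed (use assms in auto)

text \<open>Arguments are pulled back along the inverse \<open>g\<close> of \<open>h\<close>, and
  function values are pushed forward again.\<close>

lemma transport_structure: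
  fixes M :: "'u struct"
  assumes "M \<in> structures L" "bij_betw h (carrier_of M) A"
  obtains N where "N \<in> structures L" "carrier_of N = A" "isomorphism L h M N"
proof -
  define g where "g = inv_into (carrier_of M) h"
  define N where "N = Struct A
    (\<lambda>r xs. Rel r (length xs) \<in> L \<and> set xs \<subseteq> A \<and> rel_of M r (map g xs))
    (\<lambda>f xs. if Fun f (length xs) \<in> L \<and> set xs \<subseteq> A then h (fun_of M f (map g xs)) else undefined)"
  have h_in: "h x \<in> A" if "x \<in> carrier_of M" for x
    using that assms(2) bij_betwE by blast
  have g_in: "g y \<in> carrier_of M" if "y \<in> A" for y
    using that assms(2) unfolding g_def by (metis bij_betw_def inv_into_into)
  have g_h: "map (g \<circ> h) xs = xs" if "set xs \<subseteq> carrier_of M" for xs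
    using that assms(2) unfolding g_def
    by (auto intro!: map_idI simp: bij_betw_inv_into_left)
  have "|A| =o |carrier_of M|"
    using assms(2) card_of_ordIso ordIso_symmetric by blast
  moreover have "|carrier_of M| <o |UNIV :: 'u set|" "carrier_of M \<noteq> {}"
    using assms(1) unfolding structures_def by auto
  ultimately have "|A| <o |UNIV :: 'u set|" "A \<noteq> {}"
    using ordIso_ordLess_trans h_in by blast+
  moreover have "h (fun_of M f (map g xs)) \<in> A"
    if "Fun f (length xs) \<in> L" "set xs \<subseteq> A" for f xs
    using that g_in by (intro h_in fun_of_in_carrier[OF assms(1)]) auto
  ultimately have "N \<in> structures L"
    unfolding structures_def N_def by auto
  moreover have "isomorphism L h M N"
    using assms(2) h_in g_h unfolding isomorphism_def N_def by auto
  ultimately show thesis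
    using that by (simp add: N_def)
qed

text \<open>The map sending \<open>m b\<close> to \<open>n b\<close> is well defined and injective
  by \<open>eq\<close>, and onto because \<open>n\<close> enumerates \<open>N\<close>. It respects
  functions because every function value is itself named.\<close>

lemma isomorphic_if_same_diagram:
  assumes M: "M \<in> structures L" "carrier_of M = m ` B"
    and N: "N \<in> structures L" "carrier_of N = n ` B"
    and eq: "\<And>b b'. b \<in> B \<Longrightarrow> b' \<in> B \<Longrightarrow> m b = m b' \<longleftrightarrow> n b = n b'"
    and rel: "\<And>r bs. Rel r (length bs) \<in> L \<Longrightarrow> set bs \<subseteq> B \<Longrightarrow>
      rel_of M r (map m bs) \<longleftrightarrow> rel_of N r (map n bs)"
    and "fun": "\<And>f bs b. Fun f (length bs) \<in> L \<Longrightarrow> set bs \<subseteq> B \<Longrightarrow> b \<in> B \<Longrightarrow>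
      fun_of M f (map m bs) = m b \<longleftrightarrow> fun_of N f (map n bs) = n b"
  shows "isomorphic L M N"
proof -
  \<comment> \<open>An arbitrary name of \<open>x\<close> is chosen; by \<open>eq\<close> the result
    does not depend on the choice.\<close>
  define h where "h x = n (inv_into B m x)" for x
  have h: "h (m b) = n b" if "b \<in> B" for b
    using eq[of "inv_into B m (m b)" b] that
    by (auto simp: h_def f_inv_into_f inv_into_into)
  have map_h: "map h (map m bs) = map n bs" if "set bs \<subseteq> B" for bs
    using that h by auto
  have lift: "\<exists>bs. set bs \<subseteq> B \<and> xs = map m bs" if "set xs \<subseteq> carrier_of M" for xs
    using that unfolding M(2) by (rule subset_image_lists) blast
  have "bij_betw h (carrier_of M) (carrier_of N)"
    unfolding bij_betw_def M(2) N(2) inj_on_def using h eq by (auto simp: image_image)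
  moreover have "rel_of M r xs \<longleftrightarrow> rel_of N r (map h xs)"
    if "Rel r (length xs) \<in> L" "set xs \<subseteq> carrier_of M" for r xs
    using lift[OF that(2)] that(1) rel map_h by (metis length_map)
  moreover have "h (fun_of M f xs) = fun_of N f (map h xs)"
    if "Fun f (length xs) \<in> L" "set xs \<subseteq> carrier_of M" for f xs
  proof -
    from lift[OF that(2)] obtain bs where bs: "set bs \<subseteq> B" "xs = map m bs"
      by blast
    from fun_of_in_carrier[OF M(1) that] obtain b where b: "b \<in> B" "fun_of M f xs = m b"
      unfolding M(2) by blast
    then have "fun_of N f (map n bs) = n b"
      using "fun"[of f bs b] that(1) bs by simp
    then show ?thesis
      using b h bs map_h by metis
  qed
  ultimately show ?thesis
    unfolding isomorphic_def by blast
qed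

section \<open>Satisfaction\<close>

lemma eval_tm_cong:
  assumes "\<And>x. x \<in> vars_tm t \<Longrightarrow> e x = e' x"
  shows "eval_tm M e t = eval_tm M e' t"
  using assms
proof (induction t)
  case (App f ts)
  then have "map (eval_tm M e) ts = map (eval_tm M e') ts"
    by auto
  then show ?case
    by (metis eval_tm.simps(2))
qed simp

lemma sat_cong:
  assumes "\<And>x. x \<in> free_vars p \<Longrightarrow> e x = e' x"
  shows "sat M p e \<longleftrightarrow> sat M p e'"
  using assms
proof (induction p arbitrary: e e')
  case (Eq s t)
  then show ?case
    using eval_tm_cong[of s e e' M] eval_tm_cong[of t e e' M] by auto
next
  case (Atom r ts)
  then have "map (eval_tm M e) ts = map (eval_tm M e') ts"
    by (auto intro: eval_tm_cong)
  then show ?case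
    by (metis sat.simps(2))
next
  case (Neg p)
  then show ?case
    by (metis free_vars.simps(3) sat.simps(3))
next
  case (Conj I \<phi>)
  then have "sat M (\<phi> i) e \<longleftrightarrow> sat M (\<phi> i) e'" if "i \<in> I" for i
    using that by (intro Conj.IH rangeI Conj.prems) auto
  then show ?case by simp
next
  case (Disj I \<phi>)
  then have "sat M (\<phi> i) e \<longleftrightarrow> sat M (\<phi> i) e'" if "i \<in> I" for i
    using that by (intro Disj.IH rangeI Disj.prems) auto
  then show ?case by simp
next
  case (Ex x p)
  then have "sat M p (e(x := a)) \<longleftrightarrow> sat M p (e'(x := a))" for a
    by (intro Ex.IH) auto
  then show ?case by simp
next
  case (All x p)
  then have "sat M p (e(x := a)) \<longleftrightarrow> sat M p (e'(x := a))" for a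
    by (intro All.IH) auto
  then show ?case by simp
qed

lemma sat_sentence:
  assumes "free_vars p = {}"
  shows "sat M p e \<longleftrightarrow> sat M p e'"
  by (rule sat_cong) (simp add: assms)

text \<open>The domain is nonempty, so the quantifier in \<open>models\<close> is not vacuous, and
  the truth value of a sentence is the same for all assignments, even those leaving the
  domain.\<close>

lemma models_iff_sat:
  assumes "M \<in> structures L" "free_vars p = {}"
  shows "models M p \<longleftrightarrow> sat M p e"
proof -
  have eq: "sat M p e \<longleftrightarrow> sat M p e'" for e'
    by (rule sat_sentence[OF assms(2)])
  obtain a where "a \<in> carrier_of M"
    using assms(1) unfolding structures_def by blast
  then have "range (\<lambda>_::nat. a) \<subseteq> carrier_of M"
    by auto
  then show ?thesis
    unfolding models_def using eq by blast
qed

lemma formula_of_mono: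
  assumes "k \<le>o k'" "formula_of L k p"
  shows "formula_of L k' p"
  using assms by (induction p) (auto intro: ordLeq_transitive)

section \<open>Invariance of satisfaction and of projections under isomorphisms\<close>

lemma eval_tm_in_carrier:
  assumes "M \<in> structures L" "term_of L t" "range e \<subseteq> carrier_of M"
  shows "eval_tm M e t \<in> carrier_of M"
  using assms(2)
proof (induction t)
  case (App f ts)
  then show ?case
    using fun_of_in_carrier[OF assms(1), of f "map (eval_tm M e) ts"]
    by (auto simp: list_all_iff)
qed (use assms in auto)

lemma eval_tm_isomorphism:
  assumes "M \<in> structures L" "isomorphism L h M N" "term_of L t" "range e \<subseteq> carrier_of M"
  shows "h (eval_tm M e t) = eval_tm N (\<lambda>x. h (e x)) t"
  using assms(3)
proof (induction t)
  case (App f ts)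
  have *: "set (map (eval_tm M e) ts) \<subseteq> carrier_of M"
    using App.prems eval_tm_in_carrier[OF assms(1) _ assms(4)] by (auto simp: list_all_iff)
  have "map h (map (eval_tm M e) ts) = map (eval_tm N (\<lambda>x. h (e x))) ts"
    using App by (auto simp: list_all_iff)
  moreover have "h (fun_of M f (map (eval_tm M e) ts)) = fun_of N f (map h (map (eval_tm M e) ts))"
    using assms(2) App.prems * unfolding isomorphism_def by simp
  ultimately show ?case
    by (simp only: eval_tm.simps)
qed simp

text \<open>Injectivity of \<open>h\<close> settles equations and surjectivity the quantifiers.
  Assignments stay in the domain of \<open>M\<close>, where \<open>h\<close> is known to respect the
  symbols.\<close>

lemma sat_isomorphism:
  assumes "M \<in> structures L" "isomorphism L h M N" "formula_of L k p" "range e \<subseteq> carrier_of M"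
  shows "sat M p e \<longleftrightarrow> sat N p (\<lambda>x. h (e x))"
  using assms(3,4)
proof (induction p arbitrary: e)
  case (Eq s t)
  have "inj_on h (carrier_of M)"
    using assms(2) unfolding isomorphism_def bij_betw_def by blast
  then have "eval_tm M e s = eval_tm M e t \<longleftrightarrow> h (eval_tm M e s) = h (eval_tm M e t)"
    using Eq eval_tm_in_carrier[OF assms(1)] by (simp add: inj_on_eq_iff)
  then show ?case
    using Eq eval_tm_isomorphism[OF assms(1,2)] by simp
next
  case (Atom r ts)
  have *: "set (map (eval_tm M e) ts) \<subseteq> carrier_of M"
    using Atom eval_tm_in_carrier[OF assms(1)] by (auto simp: list_all_iff)
  have "map h (map (eval_tm M e) ts) = map (eval_tm N (\<lambda>x. h (e x))) ts"
    using Atom eval_tm_isomorphism[OF assms(1,2)] by (auto simp: list_all_iff)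
  moreover have "rel_of M r (map (eval_tm M e) ts) \<longleftrightarrow> rel_of N r (map h (map (eval_tm M e) ts))"
    using assms(2) Atom.prems * unfolding isomorphism_def by simp
  ultimately show ?case
    by (simp only: sat.simps)
next
  case (Ex x p)
  have "carrier_of N = h ` carrier_of M"
    using assms(2) unfolding isomorphism_def bij_betw_def by blast
  moreover have "sat M p (e(x := a)) \<longleftrightarrow> sat N p ((\<lambda>y. h (e y))(x := h a))"
    if "a \<in> carrier_of M" for a
  proof -
    have eq: "(\<lambda>y. h ((e(x := a)) y)) = (\<lambda>y. h (e y))(x := h a)"
      by auto
    have "formula_of L k p" "range (e(x := a)) \<subseteq> carrier_of M"
      using Ex.prems that by auto
    from Ex.IH[OF this] show ?thesis
      unfolding eq .
  qed
  ultimately show ?case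
    by simp
next
  case (All x p)
  have "carrier_of N = h ` carrier_of M"
    using assms(2) unfolding isomorphism_def bij_betw_def by blast
  moreover have "sat M p (e(x := a)) \<longleftrightarrow> sat N p ((\<lambda>y. h (e y))(x := h a))"
    if "a \<in> carrier_of M" for a
  proof -
    have eq: "(\<lambda>y. h ((e(x := a)) y)) = (\<lambda>y. h (e y))(x := h a)"
      by auto
    have "formula_of L k p" "range (e(x := a)) \<subseteq> carrier_of M"
      using All.prems that by auto
    from All.IH[OF this] show ?thesis
      unfolding eq .
  qed
  ultimately show ?case
    by simp
qed auto

lemma models_isomorphism:
  assumes "M \<in> structures L" "N \<in> structures L" "isomorphism L h M N"
    and "Linf_sentence L p" "models M p"
  shows "models N p"
proof -
  obtain k where k: "formula_of L k p" "free_vars p = {}"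
    using assms(4) unfolding Linf_sentence_def by blast
  obtain a where "a \<in> carrier_of M"
    using assms(1) unfolding structures_def by blast
  then have e: "range (\<lambda>_::nat. a) \<subseteq> carrier_of M"
    by auto
  then have "sat M p (\<lambda>_. a)"
    using assms(5) unfolding models_def by blast
  then show ?thesis
    using sat_isomorphism[OF assms(1,3) k(1) e] models_iff_sat[OF assms(2) k(2)] by blast
qed

text \<open>An expansion witnessing membership of \<open>M\<close> is carried along \<open>h\<close>
  to the domain of \<open>N\<close>. It still satisfies the sentence, and its reduct must be
  \<open>N\<close> because both are images of \<open>M\<close> under the same map.\<close>

lemma Sigma_definable_closed:
  assumes "Sigma_definable Linf_definable L C" "M \<in> C" "N \<in> structures L" "isomorphic L M N"
  shows "N \<in> C"
proof -
  obtain L' C' p where L': "L \<subseteq> L'" and C: "C = reduct L ` C'"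
    and p: "Linf_sentence L' p" "C' = {M \<in> structures L'. models M p}"
    using assms(1) unfolding Sigma_definable_def Linf_definable_def by blast
  obtain M' where M': "M' \<in> structures L'" "models M' p" "M = reduct L M'"
    using assms(2) C p by auto
  obtain h where h: "isomorphism L h M N"
    using assms(4) isomorphic_iff by blast
  then have "bij_betw h (carrier_of M') (carrier_of N)"
    using M'(3) unfolding isomorphism_def by simp
  then obtain N' where N': "N' \<in> structures L'" "carrier_of N' = carrier_of N"
    "isomorphism L' h M' N'"
    using transport_structure[OF M'(1)] by metis
  have "isomorphism L h M (reduct L N')"
    using isomorphism_reduct[OF L' N'(3)] M'(3) by simp
  then have "N = reduct L N'"
    using isomorphism_unique[OF assms(3) reduct_in_structures[OF L' N'(1)] h] N'(2) by simp
  moreover have "models N' p"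
    using models_isomorphism[OF M'(1) N'(1,3) p(1) M'(2)] .
  ultimately show ?thesis
    using C p(2) N'(1) by blast
qed

section \<open>Definability\<close>

text \<open>
  The defining sentence is the disjunction, over the patterns of truth values of sentences from
  \<open>S\<close> realised in \<open>X\<close>, of the conjunctions describing these patterns.
\<close>

lemma Linf_definable_if_determined:
  fixes X :: "'u struct set"
  assumes U: "set_universe TYPE('u)"
    and k: "cardinal k"
    and S: "|S| <o |UNIV :: 'u set|"
      "\<And>s. s \<in> S \<Longrightarrow> formula_of L k s" "\<And>s. s \<in> S \<Longrightarrow> free_vars s = {}"
    and X: "X \<subseteq> structures L"
    and closed: "\<And>M N. M \<in> X \<Longrightarrow> N \<in> structures L \<Longrightarrow>
      (\<And>s e. s \<in> S \<Longrightarrow> sat M s e \<longleftrightarrow> sat N s e) \<Longrightarrow> N \<in> X"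
  shows "Linf_definable L X"
proof -
  \<comment> \<open>\<open>\<sigma>\<close> lists the sentences of \<open>S\<close> by indices in
    \<open>'u\<close>; \<open>\<tau>\<close> below lists all subsets of \<open>I\<close>, the
    conceivable truth patterns.\<close>
  obtain I :: "'u set" and \<sigma> where \<sigma>: "bij_betw \<sigma> I S" and I: "|I| <o |UNIV :: 'u set|"
    by (rule small_obtains_bij[OF S(1)])
  have S_eq: "S = \<sigma> ` I"
    using \<sigma> unfolding bij_betw_def by simp
  obtain J :: "'u set" and \<tau> where \<tau>: "bij_betw \<tau> J (Pow I)" and J: "|J| <o |UNIV :: 'u set|"
    by (rule small_obtains_bij[OF small_Pow[OF U I]])
  \<comment> \<open>A single bound for the conjunctions over \<open>I\<close>, the disjunction over
    a part of \<open>J\<close>, and the connectives inside \<open>S\<close>.\<close>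
  define k' where "k' = |I \<union> J \<union> Field k|"
  have k_iso: "|Field k| =o k"
    using k card_of_Field_ordIso unfolding cardinal_def by blast
  then have "|Field k| <o |UNIV :: 'u set|"
    using k ordIso_ordLess_trans unfolding cardinal_def by blast
  then have k': "cardinal k'"
    unfolding cardinal_def k'_def using small_Un U I J by (auto simp: card_of_Card_order)
  have "k \<le>o k'"
    unfolding k'_def using ordIso_ordLeq_trans[OF ordIso_symmetric[OF k_iso] card_of_mono1] by blast
  define \<delta> where "\<delta> j = Conj I (\<lambda>i. if i \<in> \<tau> j then \<sigma> i else Neg (\<sigma> i))" for j
  define J' where "J' = {j \<in> J. \<exists>M\<in>X. \<forall>i\<in>I. \<forall>e. i \<in> \<tau> j \<longleftrightarrow> sat M (\<sigma> i) e}"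
  define p where "p = Disj J' \<delta>"
  have "|J'| \<le>o k'" "|I| \<le>o k'"
    unfolding k'_def J'_def by (auto intro: card_of_mono1)
  then have "formula_of L k' p"
    unfolding p_def \<delta>_def using formula_of_mono[OF \<open>k \<le>o k'\<close>] S(2) S_eq by auto
  moreover have fv: "free_vars p = {}"
    unfolding p_def \<delta>_def using S(3) S_eq by auto
  ultimately have "Linf_sentence L p"
    using k' unfolding Linf_sentence_def by blast
  moreover have "X = {M \<in> structures L. models M p}"
  proof (intro equalityI subsetI CollectI conjI)
    fix M assume M: "M \<in> X"
    then show M': "M \<in> structures L"
      using X by blast
    have indep: "sat M (\<sigma> i) e \<longleftrightarrow> sat M (\<sigma> i) e'" if "i \<in> I" for i e e'
      using S_eq that by (intro sat_sentence S(3)) blast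
    \<comment> \<open>The pattern of \<open>M\<close>; \<open>undefined\<close> serves as an
      arbitrary assignment, which is harmless for sentences.\<close>
    define T where "T = {i \<in> I. sat M (\<sigma> i) undefined}"
    have "T \<in> \<tau> ` J"
      using \<tau> unfolding bij_betw_def T_def by blast
    then obtain j where j: "j \<in> J" "\<tau> j = T"
      by blast
    have T: "i \<in> T \<longleftrightarrow> sat M (\<sigma> i) e" if "i \<in> I" for i e
      using that indep unfolding T_def by blast
    then have "j \<in> J'"
      using j M unfolding J'_def by blast
    moreover have "sat M (\<delta> j) e" for e
      unfolding \<delta>_def using j(2) T by auto
    ultimately show "models M p"
      unfolding models_def p_def by auto
  next
    fix N assume "N \<in> {M \<in> structures L. models M p}"
    then have N: "N \<in> structures L" "\<And>e. sat N p e"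
      using models_iff_sat fv by blast+
    then obtain j where j: "j \<in> J'" "sat N (\<delta> j) undefined"
      unfolding p_def by auto
    then obtain M where M: "M \<in> X" "\<And>i e. i \<in> I \<Longrightarrow> i \<in> \<tau> j \<longleftrightarrow> sat M (\<sigma> i) e"
      unfolding J'_def by blast
    \<comment> \<open>\<open>N\<close> has the pattern \<open>\<tau> j\<close>, which
      \<open>M\<close> in \<open>X\<close> realises, so the two agree on \<open>S\<close>.\<close>
    show "N \<in> X"
    proof (rule closed[OF M(1) N(1)])
      fix s e assume "s \<in> S"
      then obtain i where i: "i \<in> I" "s = \<sigma> i"
        using S_eq by blast
      have "sat N s e \<longleftrightarrow> sat N s undefined"
        by (rule sat_sentence[OF S(3)[OF \<open>s \<in> S\<close>]])
      also have "\<dots> \<longleftrightarrow> i \<in> \<tau> j"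
        using j(2) i unfolding \<delta>_def by (auto split: if_splits)
      also have "\<dots> \<longleftrightarrow> sat M s e"
        using M(2) i by blast
      finally show "sat M s e \<longleftrightarrow> sat N s e"
        by blast
    qed
  qed
  ultimately show ?thesis
    unfolding Linf_definable_def by blast
qed

section \<open>Naming elements by constants: diagrams and expansions\<close>

abbreviation const :: "'u \<Rightarrow> 'u tm" where
  "const b \<equiv> App b []"

definition all_named :: "'u set \<Rightarrow> 'u fm" where
  "all_named B = All 0 (Disj B (\<lambda>b. Eq (Var 0) (const b)))"

definition all_distinct :: "'u set \<Rightarrow> 'u fm" where
  "all_distinct B = Conj B (\<lambda>b. Conj (B - {b}) (\<lambda>b'. Neg (Eq (const b) (const b'))))"

text \<open>Unnested atomic sentences in the new constants; function symbols enter through their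
  graphs. When every element is named, their truth values amount to the Robinson diagram of the
  \<open>L\<close>-reduct.\<close>

definition diagram_sentences :: "'u symbol set \<Rightarrow> 'u set \<Rightarrow> 'u fm set" where
  "diagram_sentences L B =
     {Eq (const b) (const b') |b b'. b \<in> B \<and> b' \<in> B} \<union>
     {Atom r (map const bs) |r bs. Rel r (length bs) \<in> L \<and> set bs \<subseteq> B} \<union>
     {Eq (App f (map const bs)) (const b) |f bs b. Fun f (length bs) \<in> L \<and> set bs \<subseteq> B \<and> b \<in> B}"

definition add_constants :: "'u symbol set \<Rightarrow> 'u set \<Rightarrow> 'u symbol set" where
  "add_constants L B = L \<union> (\<lambda>b. Fun b 0) ` B"

lemma sat_all_named:
  assumes "M \<in> structures (add_constants L B)"
  shows "sat M (all_named B) e \<longleftrightarrow> carrier_of M = (\<lambda>b. fun_of M b []) ` B"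
proof -
  have "fun_of M b [] \<in> carrier_of M" if "b \<in> B" for b
    using fun_of_in_carrier[OF assms, of b "[]"] that by (simp add: add_constants_def)
  then show ?thesis
    by (auto simp: all_named_def)
qed

lemma sat_all_distinct:
  "sat M (all_distinct B) e \<longleftrightarrow> inj_on (\<lambda>b. fun_of M b []) B"
  by (auto simp: all_distinct_def inj_on_def)

text \<open>Each sentence is specified by at most one symbol and finitely many constants, so images
  of small products cover the set.\<close>

lemma small_diagram_sentences:
  fixes L :: "'u symbol set"
  assumes U: "set_universe TYPE('u)"
    and "|L| <o |UNIV :: 'u set|" "|B| <o |UNIV :: 'u set|"
  shows "|diagram_sentences L B| <o |UNIV :: 'u set|"
proof -
  \<comment> \<open>Forgets the kind and arity of a symbol; in a sentence the arity reappears as the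
    length of \<open>bs\<close>.\<close>
  define name :: "'u symbol \<Rightarrow> 'u" where "name s = (case s of Rel r n \<Rightarrow> r | Fun f n \<Rightarrow> f)" for s
  have lists: "|lists B| <o |UNIV :: 'u set|"
    by (rule small_lists[OF U assms(3)])
  have "|(\<lambda>(b, b'). Eq (const b) (const b')) ` (B \<times> B) \<union>
      (\<lambda>(s, bs). Atom (name s) (map const bs)) ` (L \<times> lists B) \<union>
      (\<lambda>(s, bs, b). Eq (App (name s) (map const bs)) (const b)) ` (L \<times> lists B \<times> B)|
    <o |UNIV :: 'u set|"
    by (intro small_Un[OF U] small_image small_Times[OF U] assms lists)
  moreover have "diagram_sentences L B \<subseteq>
      (\<lambda>(b, b'). Eq (const b) (const b')) ` (B \<times> B) \<union>
      (\<lambda>(s, bs). Atom (name s) (map const bs)) ` (L \<times> lists B) \<union>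
      (\<lambda>(s, bs, b). Eq (App (name s) (map const bs)) (const b)) ` (L \<times> lists B \<times> B)"
  proof -
    have "Atom r (map const bs) \<in> (\<lambda>(s, bs). Atom (name s) (map const bs)) ` (L \<times> lists B)"
      if "Rel r (length bs) \<in> L" "set bs \<subseteq> B" for r bs
      using that by (intro image_eqI[of _ _ "(Rel r (length bs), bs)"]) (auto simp: name_def)
    moreover have "Eq (App f (map const bs)) (const b) \<in>
        (\<lambda>(s, bs, b). Eq (App (name s) (map const bs)) (const b)) ` (L \<times> lists B \<times> B)"
      if "Fun f (length bs) \<in> L" "set bs \<subseteq> B" "b \<in> B" for f bs b
      using that by (intro image_eqI[of _ _ "(Fun f (length bs), bs, b)"]) (auto simp: name_def)
    moreover have "Eq (const b) (const b') \<in> (\<lambda>(b, b'). Eq (const b) (const b')) ` (B \<times> B)"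
      if "b \<in> B" "b' \<in> B" for b b'
      using that by (intro image_eqI[of _ _ "(b, b')"]) auto
    ultimately show ?thesis
      unfolding diagram_sentences_def by (intro Un_mono subsetI) (elim CollectE exE conjE, simp only:)+
  qed
  ultimately show ?thesis
    using small_subset by blast
qed

lemma diagram_sentence:
  assumes "s \<in> {all_named B, all_distinct B} \<union> diagram_sentences L B"
  shows "formula_of (add_constants L B) |B| s \<and> free_vars s = {}"
proof -
  have "|B - {b}| \<le>o |B|" "|B| \<le>o |B|" for b
    by (auto intro: card_of_mono1)
  then have "formula_of (add_constants L B) |B| s \<and> free_vars s = {}"
    if "s \<in> {all_named B, all_distinct B}"
    using that by (auto simp: all_named_def all_distinct_def add_constants_def split: if_splits)
  moreover have "formula_of (add_constants L B) |B| s \<and> free_vars s = {}"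
    if "s \<in> diagram_sentences L B"
    using that by (auto simp: diagram_sentences_def add_constants_def list_all_iff subset_iff)
  ultimately show ?thesis
    using assms by blast
qed

text \<open>The constants enumerate both domains, so \<open>isomorphic_if_same_diagram\<close>
  applies with the denotation maps as \<open>m\<close> and \<open>n\<close>.\<close>

lemma isomorphic_reducts_if_same_diagram:
  assumes M: "M \<in> structures (add_constants L B)" "sat M (all_named B) e"
    and N: "N \<in> structures (add_constants L B)" "sat N (all_named B) e"
    and same: "\<And>s. s \<in> diagram_sentences L B \<Longrightarrow> sat M s e \<longleftrightarrow> sat N s e"
  shows "isomorphic L (reduct L M) (reduct L N)"
proof (rule isomorphic_if_same_diagram)
  have sub: "L \<subseteq> add_constants L B"
    by (auto simp: add_constants_def)
  show "reduct L M \<in> structures L" "reduct L N \<in> structures L"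
    using reduct_in_structures[OF sub] M(1) N(1) by auto
  show "carrier_of (reduct L M) = (\<lambda>b. fun_of M b []) ` B"
    "carrier_of (reduct L N) = (\<lambda>b. fun_of N b []) ` B"
    using sat_all_named[OF M(1), of e] M(2) sat_all_named[OF N(1), of e] N(2) by simp_all
  have eval_const: "eval_tm A e \<circ> const = (\<lambda>b. fun_of A b [])" for A :: "'a struct"
    by auto
  show "fun_of M b [] = fun_of M b' [] \<longleftrightarrow> fun_of N b [] = fun_of N b' []"
    if "b \<in> B" "b' \<in> B" for b b'
    using same[of "Eq (const b) (const b')"] that by (auto simp: diagram_sentences_def)
  show "rel_of (reduct L M) r (map (\<lambda>b. fun_of M b []) bs) \<longleftrightarrow>
      rel_of (reduct L N) r (map (\<lambda>b. fun_of N b []) bs)"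
    if "Rel r (length bs) \<in> L" "set bs \<subseteq> B" for r bs
  proof -
    have "Atom r (map const bs) \<in> diagram_sentences L B"
      using that unfolding diagram_sentences_def by blast
    then show ?thesis
      using same[of "Atom r (map const bs)"] that(1) eval_const by (simp add: reduct_def)
  qed
  show "fun_of (reduct L M) f (map (\<lambda>b. fun_of M b []) bs) = fun_of M b [] \<longleftrightarrow>
      fun_of (reduct L N) f (map (\<lambda>b. fun_of N b []) bs) = fun_of N b []"
    if "Fun f (length bs) \<in> L" "set bs \<subseteq> B" "b \<in> B" for f bs b
  proof -
    have "Eq (App f (map const bs)) (const b) \<in> diagram_sentences L B"
      using that unfolding diagram_sentences_def by blast
    then show ?thesis
      using same[of "Eq (App f (map const bs)) (const b)"] that(1) eval_const
      by (simp add: reduct_def)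
  qed
qed

text \<open>Freshness ensures that overriding the value at the empty argument list touches no symbol
  of \<open>L\<close>, so the reduct gives back \<open>M\<close>.\<close>

lemma expand_by_constants:
  assumes "M \<in> structures L" "\<And>b n. b \<in> B \<Longrightarrow> Fun b n \<notin> L" "g ` B \<subseteq> carrier_of M"
  obtains M' where "M' \<in> structures (add_constants L B)" "reduct L M' = M"
    "\<And>b. b \<in> B \<Longrightarrow> fun_of M' b [] = g b"
proof -
  define M' where "M' = Struct (carrier_of M) (rel_of M)
    (\<lambda>f xs. if f \<in> B \<and> xs = [] then g f else fun_of M f xs)"
  note rel = rel_ofD[OF assms(1)] and undef = fun_of_undefined[OF assms(1)]
  have "M' \<in> structures (add_constants L B)"
    using assms(1) rel undef fun_of_in_carrier[OF assms(1)] assms(3)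
    unfolding structures_def M'_def add_constants_def by auto
  moreover have "reduct L M' = M"
  proof -
    have "(if Fun f (length xs) \<in> L then fun_of M' f xs else undefined) = fun_of M f xs" for f xs
      using undef[of f xs] assms(2) unfolding M'_def by auto
    moreover have "(Rel r (length xs) \<in> L \<and> rel_of M' r xs) = rel_of M r xs" for r xs
      using rel unfolding M'_def by auto
    ultimately show ?thesis
      unfolding reduct_def by (simp add: M'_def)
  qed
  moreover have "fun_of M' b [] = g b" if "b \<in> B" for b
    using that by (simp add: M'_def)
  ultimately show thesis
    using that by blast
qed

text \<open>Distinct constants serve to show that the domain has at least \<open>|B|\<close>
  elements; this is enough because \<open>large\<close> makes \<open>C\<close> contain all such
  structures or none. The complement inherits this dichotomy, so the lemma serves both halves of
  \<open>Delta_definable\<close>.\<close>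

lemma Sigma_definable_if_large_indistinguishable:
  fixes L :: "'u symbol set" and C :: "'u struct set"
  assumes U: "set_universe TYPE('u)" and L: "vocabulary L"
    and B: "|B| <o |UNIV :: 'u set|" "\<And>b n. b \<in> B \<Longrightarrow> Fun b n \<notin> L"
    and C: "C \<subseteq> structures L" "closed_under_isomorphisms L C"
    and large: "\<And>M N. M \<in> C \<Longrightarrow> N \<in> structures L \<Longrightarrow> |B| \<le>o |carrier_of M| \<Longrightarrow>
      |B| \<le>o |carrier_of N| \<Longrightarrow> N \<in> C"
  shows "Sigma_definable Linf_definable L C"
proof -
  define L' where "L' = add_constants L B"
  have sub: "L \<subseteq> L'"
    by (auto simp: L'_def add_constants_def)
  have small_L: "|L| <o |UNIV :: 'u set|"
    using L unfolding vocabulary_def .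
  have "vocabulary L'"
    unfolding vocabulary_def L'_def add_constants_def
    by (intro small_Un[OF U] small_image small_L B)
  define S where "S = {all_named B, all_distinct B} \<union> diagram_sentences L B"
  \<comment> \<open>The guard discards expansions whose constants neither name everything nor are
    distinct, as their truth patterns need not decide membership in \<open>C\<close>.\<close>
  define X where "X = {M \<in> structures L'. reduct L M \<in> C \<and>
    (\<forall>e. sat M (all_named B) e \<or> sat M (all_distinct B) e)}"
  have distinct_large: "|B| \<le>o |carrier_of (reduct L M)|"
    if "M \<in> structures L'" "sat M (all_distinct B) e" for M e
  proof -
    have "fun_of M b [] \<in> carrier_of M" if "b \<in> B" for b
      using fun_of_in_carrier[OF \<open>M \<in> structures L'\<close>, of b "[]"] that
      by (simp add: L'_def add_constants_def)
    then show ?thesis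
      using that(2) card_of_ordLeqI[of "\<lambda>b. fun_of M b []" B] by (simp add: sat_all_distinct)
  qed
  have "Linf_definable L' X"
  proof (rule Linf_definable_if_determined[OF U])
    show "cardinal |B|"
      using B(1) by (simp add: cardinal_def card_of_Card_order)
    have "|{all_named B, all_distinct B}| <o |UNIV :: 'u set|"
      by (rule small_finite[OF U]) simp
    then show "|S| <o |UNIV :: 'u set|"
      unfolding S_def by (intro small_Un[OF U] small_diagram_sentences[OF U small_L B(1)])
    show "formula_of L' |B| s" "free_vars s = {}" if "s \<in> S" for s
      using diagram_sentence that unfolding S_def L'_def by blast+
    show "X \<subseteq> structures L'"
      unfolding X_def by blast
    fix M N assume M: "M \<in> X" and N: "N \<in> structures L'"
      and same: "\<And>s e. s \<in> S \<Longrightarrow> sat M s e \<longleftrightarrow> sat N s e"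
    have M': "M \<in> structures L'" "reduct L M \<in> C"
      using M unfolding X_def by auto
    have N': "reduct L N \<in> structures L"
      by (rule reduct_in_structures[OF sub N])
    have same_named: "sat M (all_named B) e \<longleftrightarrow> sat N (all_named B) e"
      and same_distinct: "sat M (all_distinct B) e \<longleftrightarrow> sat N (all_distinct B) e" for e
      using same unfolding S_def by auto
    \<comment> \<open>If everything is named, equal diagrams give isomorphic reducts. Otherwise the
      constants are distinct in both structures, so both are large and \<open>large\<close>
      applies.\<close>
    have "reduct L N \<in> C"
    proof (cases "sat M (all_named B) undefined")
      case True
      then have "isomorphic L (reduct L M) (reduct L N)"
        using isomorphic_reducts_if_same_diagram M'(1) N same same_named
        unfolding L'_def S_def by blast
      then show ?thesis
        using C(2) M'(2) N' unfolding closed_under_isomorphisms_def by blast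
    next
      case False
      then have "sat M (all_distinct B) undefined"
        using M unfolding X_def by blast
      then show ?thesis
        using large[OF M'(2) N'] distinct_large[OF M'(1)] distinct_large[OF N] same_distinct
        by blast
    qed
    then show "N \<in> X"
      using M N same_named same_distinct unfolding X_def by blast
  qed
  moreover have "C = reduct L ` X"
  proof
    show "reduct L ` X \<subseteq> C"
      unfolding X_def by blast
    show "C \<subseteq> reduct L ` X"
    proof
      fix M assume M: "M \<in> C"
      then have M_L: "M \<in> structures L"
        using C(1) by blast
      then have nonempty: "carrier_of M \<noteq> {}"
        unfolding structures_def by blast
      \<comment> \<open>Comparability of cardinals decides the kind of naming: \<open>B\<close> maps
        onto a nonempty domain of at most \<open>|B|\<close> elements and injects into any
        other.\<close>
      have "\<exists>g. g ` B \<subseteq> carrier_of M \<and> (g ` B = carrier_of M \<or> inj_on g B)"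
      proof (cases "|carrier_of M| \<le>o |B|")
        case True
        then obtain g where "g ` B = carrier_of M"
          using card_of_ordLeq2[OF nonempty, of B] by auto
        then show ?thesis
          by (intro exI[of _ g]) simp
      next
        case False
        then have "|B| \<le>o |carrier_of M|"
          using ordLeq_total card_of_Well_order by blast
        then obtain g where "inj_on g B" "g ` B \<subseteq> carrier_of M"
          using card_of_ordLeq[of B "carrier_of M"] by auto
        then show ?thesis
          by (intro exI[of _ g]) simp
      qed
      then obtain g where g: "g ` B \<subseteq> carrier_of M" "g ` B = carrier_of M \<or> inj_on g B"
        by blast
      obtain M' where M': "M' \<in> structures L'" "reduct L M' = M"
        "\<And>b. b \<in> B \<Longrightarrow> fun_of M' b [] = g b"
        using expand_by_constants[OF M_L B(2) g(1)] unfolding L'_def by blast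
      have "carrier_of M' = carrier_of M"
        using M'(2) carrier_reduct by metis
      then have "sat M' (all_named B) e \<or> sat M' (all_distinct B) e" for e
        using g(2) M'(1,3) sat_all_named[of M' L B e] sat_all_distinct[of M' B e]
        unfolding L'_def by (auto simp: inj_on_def)
      then have "M' \<in> X"
        using M M' unfolding X_def by auto
      then show "M \<in> reduct L ` X"
        using M'(2) by blast
    qed
  qed
  ultimately show ?thesis
    unfolding Sigma_definable_def using \<open>vocabulary L'\<close> sub by blast
qed

section \<open>Slices of a class by cardinality, and the equivalence\<close>

lemma isomorphic_card:
  assumes "isomorphic L M N"
  shows "|carrier_of M| =o |carrier_of N|"
  using assms card_of_ordIso unfolding isomorphic_def by blast

text \<open>The inverse of \<open>h\<close> works; function values are compared after applying
  \<open>h\<close>, which is then cancelled. Symmetry is what makes the complement of a closed class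
  closed.\<close>

lemma isomorphic_sym:
  assumes "M \<in> structures L" "N \<in> structures L" "isomorphic L M N"
  shows "isomorphic L N M"
proof -
  obtain h where h: "isomorphism L h M N"
    using assms(3) isomorphic_iff by blast
  define g where "g = inv_into (carrier_of M) h"
  have bij: "bij_betw h (carrier_of M) (carrier_of N)"
    using h unfolding isomorphism_def by blast
  have g: "bij_betw g (carrier_of N) (carrier_of M)"
    using bij unfolding g_def by (rule bij_betw_inv_into)
  have map_g: "set (map g ys) \<subseteq> carrier_of M" "map h (map g ys) = ys"
    if "set ys \<subseteq> carrier_of N" for ys
  proof -
    show "set (map g ys) \<subseteq> carrier_of M"
      using that g bij_betwE by fastforce
    show "map h (map g ys) = ys"
      using that bij unfolding g_def
      by (auto intro!: map_idI simp: bij_betw_inv_into_right)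
  qed
  have "rel_of N r ys \<longleftrightarrow> rel_of M r (map g ys)"
    if "Rel r (length ys) \<in> L" "set ys \<subseteq> carrier_of N" for r ys
    using h map_g[OF that(2)] that(1) unfolding isomorphism_def by (metis length_map)
  moreover have "g (fun_of N f ys) = fun_of M f (map g ys)"
    if "Fun f (length ys) \<in> L" "set ys \<subseteq> carrier_of N" for f ys
  proof -
    have "h (fun_of M f (map g ys)) = fun_of N f ys"
      using h map_g[OF that(2)] that(1) unfolding isomorphism_def by (metis length_map)
    moreover have "fun_of M f (map g ys) \<in> carrier_of M"
      using fun_of_in_carrier[OF assms(1)] map_g(1)[OF that(2)] that(1) by simp
    ultimately show ?thesis
      using bij unfolding g_def by (metis bij_betw_inv_into_left)
  qed
  ultimately show ?thesis
    using g unfolding isomorphic_def by blast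
qed

theorem theorem18:
  fixes L :: "'u symbol set" and K :: "'u struct set"
  assumes "set_universe TYPE('u)"
    and "vocabulary L"
    and "K \<subseteq> structures L"
  shows "closed_under_isomorphisms L K \<longleftrightarrow>
         cardinal_dependently_definable (Delta_definable Linf_definable) L K"
proof
  assume closed: "closed_under_isomorphisms L K"
  show "cardinal_dependently_definable (Delta_definable Linf_definable) L K"
    unfolding cardinal_dependently_definable_def
  proof (intro allI impI)
    fix k :: "'u rel" assume k: "cardinal k"
    have k_iso: "|Field k| =o k"
      using k card_of_Field_ordIso unfolding cardinal_def by blast
    then have small_k: "|Field k| <o |UNIV :: 'u set|"
      using k ordIso_ordLess_trans unfolding cardinal_def by blast
    \<comment> \<open>Avoiding the names of all symbols, whatever their kind or arity, makes every
      constant from \<open>B\<close> fresh for \<open>L\<close>.\<close>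
    define name :: "'u symbol \<Rightarrow> 'u" where
      "name s = (case s of Rel r n \<Rightarrow> r | Fun f n \<Rightarrow> f)" for s
    have "|name ` L| <o |UNIV :: 'u set|"
      using assms(2) small_image unfolding vocabulary_def by blast
    \<comment> \<open>The power set makes \<open>B\<close> strictly larger than \<open>k\<close>,
      for finite \<open>k\<close> as well, while inaccessibility keeps it small.\<close>
    then obtain B :: "'u set" where B: "B \<inter> name ` L = {}" "|B| =o |Pow (Field k)|"
      using obtains_fresh_set[OF assms(1) _ small_Pow[OF assms(1) small_k]] by blast
    have small_B: "|B| <o |UNIV :: 'u set|"
      using B(2) small_Pow[OF assms(1) small_k] ordIso_ordLess_trans by blast
    have fresh: "Fun b n \<notin> L" if "b \<in> B" for b n
    proof
      assume "Fun b n \<in> L"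
      then have "name (Fun b n) \<in> name ` L"
        by (rule imageI)
      then show False
        using B(1) that by (auto simp: name_def)
    qed
    have "k <o |B|"
      using ordIso_ordLess_trans[OF ordIso_symmetric[OF k_iso]
          ordLess_ordIso_trans[OF card_of_Pow ordIso_symmetric[OF B(2)]]] .
    then have not_large: "\<not> |B| \<le>o |carrier_of M|" if "M \<in> of_cardinality K k" for M
      using that not_ordLess_ordIso ordLess_ordLeq_trans ordIso_symmetric
      unfolding of_cardinality_def by blast
    have closed_k: "N \<in> of_cardinality K k"
      if "M \<in> of_cardinality K k" "N \<in> structures L" "isomorphic L M N" for M N
      using that closed isomorphic_card[OF that(3)] ordIso_symmetric ordIso_transitive
      unfolding of_cardinality_def closed_under_isomorphisms_def by blast
    have sub: "of_cardinality K k \<subseteq> structures L"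
      using assms(3) unfolding of_cardinality_def by blast
    show "Delta_definable Linf_definable L (of_cardinality K k)"
      unfolding Delta_definable_def
    proof
      show "Sigma_definable Linf_definable L (of_cardinality K k)"
      proof (rule Sigma_definable_if_large_indistinguishable[OF assms(1,2) small_B fresh sub])
        show "closed_under_isomorphisms L (of_cardinality K k)"
          unfolding closed_under_isomorphisms_def using closed_k by blast
      \<comment> \<open>Members have \<open>k\<close> elements and \<open>k\<close> is below
        \<open>|B|\<close>, so the condition on large structures holds vacuously.\<close>
      qed (use not_large in blast)+
      show "Sigma_definable Linf_definable L (structures L - of_cardinality K k)"
      proof (rule Sigma_definable_if_large_indistinguishable[OF assms(1,2) small_B fresh])
        show "closed_under_isomorphisms L (structures L - of_cardinality K k)"
          unfolding closed_under_isomorphisms_def using closed_k isomorphic_sym by blast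
      \<comment> \<open>Every structure with at least \<open>|B|\<close> elements lies outside
        \<open>of_cardinality K k\<close>, hence in the complement.\<close>
      qed (use not_large in blast)+
    qed
  qed
next
  assume definable: "cardinal_dependently_definable (Delta_definable Linf_definable) L K"
  show "closed_under_isomorphisms L K"
    unfolding closed_under_isomorphisms_def
  proof (intro ballI impI)
    fix M N assume M: "M \<in> K" and N: "N \<in> structures L" and iso: "isomorphic L M N"
    \<comment> \<open>The cardinality of \<open>M\<close> itself is the instance to use: the
      isomorphic \<open>N\<close> then falls into the same definable slice of
      \<open>K\<close>.\<close>
    have "cardinal |carrier_of M|"
      using M assms(3) unfolding cardinal_def structures_def by (auto simp: card_of_Card_order)
    then have "Sigma_definable Linf_definable L (of_cardinality K |carrier_of M| )"
      using definable unfolding cardinal_dependently_definable_def Delta_definable_def by blast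
    moreover have "M \<in> of_cardinality K |carrier_of M|"
      using M by (simp add: of_cardinality_def card_of_refl)
    ultimately have "N \<in> of_cardinality K |carrier_of M|"
      using Sigma_definable_closed N iso by blast
    then show "N \<in> K"
      unfolding of_cardinality_def by blast
  qed
qed

end
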